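(* Let $n,p\ge 1$ and let $\alpha=(\alpha_1,\alpha_2,\ldots,\alpha_p)$ and $\beta=(\beta_1,\beta_2,\ldots,\beta_p)$ be two sequences of index sets. If the ratio $\alpha/\beta$ is bounded for all totally positive $n\times n$ matrices, then it satisfies condition (M).
   Context: A real $n\times n$ matrix is totally positive if all of its minors are positive. An index set is an $n$-element subset of $\{1,\ldots,2n\}$. For a totally positive $n\times n$ matrix $A$, let $\bar A$ be the $2n\times n$ matrix whose upper $n\times n$ block is $A$ and whose lower $n\times n$ block has entry $(-1)^{k-1}$ in position $(k,n+1-k)$ for $k=1,\ldots,n$ and zeros elsewhere. For an index set $\gamma$, $[\gamma](A)$ is the determinant of the $n\times n$ submatrix of $\bar A$ formed by the rows indexed by $\gamma$ (in increasing order); these are exactly the minors of $A$, via $[I\cup\{2n+1-i: i\in\{1,\ldots,n\}\setminus I'\}](A)=\det A(I|I')$ (and $1$ when $I=I'=\emptyset$), and all are positive. For sequences $\alpha,\beta$ of $p$ index sets, put $\alpha(A)=\prod_{i=1}^p[\alpha_i](A)$ and $\beta(A)=\prod_{i=1}^p[\beta_i](A)$. The ratio $\alpha/\beta$ is bounded if there is $k>0$ with $\alpha(A)/\beta(A)\le k$ for all totally positive $n\times n$ matrices $A$. Majorization: for non-increasing sequences $x=(x_1,\ldots,x_p)$, $y=(y_1,\ldots,y_p)$ of non-negative integers, $x\succeq y$ means $\sum_{i=1}^k x_i\ge\sum_{i=1}^k y_i$ for each $k=1,\ldots,p$, with equality for $k=p$. Interval: a subset $L\subseteq\{1,\ldots,2n\}$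 such that $L$ or its complement in $\{1,\ldots,2n\}$ has the form $\{i,i+1,\ldots,i+m\}$ (consecutive integers). For $L\subseteq\{1,\ldots,2n\}$, $m(\alpha,L)$ denotes the non-increasing rearrangement of $(|\alpha_1\cap L|,\ldots,|\alpha_p\cap L|)$. The ratio $\alpha/\beta$ satisfies condition (M) if $m(\alpha,L)\succeq m(\beta,L)$ for every interval $L$. *)

theory Defs
  imports
    Complex_Main
    "Jordan_Normal_Form.Determinant"
    "Jordan_Normal_Form.DL_Submatrix"
begin

text \<open>Matrix positions are numbered from 0, as in the matrix library; index sets and intervals are
  subsets of \<open>{1..2*n}\<close>. The element \<open>r\<close> of an index set stands for matrix row \<open>r - 1\<close>.\<close>

definition totally_positive :: "nat \<Rightarrow> real mat \<Rightarrow> bool" where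
  "totally_positive n A \<longleftrightarrow> A \<in> carrier_mat n n \<and>
     (\<forall>I J. I \<subseteq> {..<n} \<and> J \<subseteq> {..<n} \<and> I \<noteq> {} \<and> card I = card J \<longrightarrow> 0 < det (submatrix A I J))"

definition index_set :: "nat \<Rightarrow> nat set \<Rightarrow> bool" where
  "index_set n \<gamma> \<longleftrightarrow> \<gamma> \<subseteq> {1..2*n} \<and> card \<gamma> = n"

text \<open>In 1-based terms, the lower block has the entry \<open>(-1)^(k-1)\<close> in position \<open>(k, n+1-k)\<close>;
  below, \<open>k = i - n + 1\<close>.\<close>

definition extended_mat :: "nat \<Rightarrow> real mat \<Rightarrow> real mat" where
  "extended_mat n A = mat (2*n) n (\<lambda>(i, j).
     if i < n then A $$ (i, j)
     else if j = n - 1 - (i - n) then (-1) ^ (i - n)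
     else 0)"

definition minor :: "nat \<Rightarrow> nat set \<Rightarrow> real mat \<Rightarrow> real" where
  "minor n \<gamma> A = det (submatrix (extended_mat n A) ((\<lambda>r. r - 1) ` \<gamma>) UNIV)"

definition minor_prod :: "nat \<Rightarrow> nat set list \<Rightarrow> real mat \<Rightarrow> real" where
  "minor_prod n \<alpha> A = (\<Prod>\<gamma>\<leftarrow>\<alpha>. minor n \<gamma> A)"

definition bounded_ratio :: "nat \<Rightarrow> nat set list \<Rightarrow> nat set list \<Rightarrow> bool" where
  "bounded_ratio n \<alpha> \<beta> \<longleftrightarrow>
     (\<exists>k>0. \<forall>A. totally_positive n A \<longrightarrow> minor_prod n \<alpha> A / minor_prod n \<beta> A \<le> k)"

text \<open>Meant for non-increasing lists.\<close>

definition majorizes :: "nat list \<Rightarrow> nat list \<Rightarrow> bool" where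
  "majorizes x y \<longleftrightarrow> length x = length y \<and>
     (\<forall>k\<in>{1..length x}. sum_list (take k x) \<ge> sum_list (take k y)) \<and>
     sum_list x = sum_list y"

definition cyclic_interval :: "nat \<Rightarrow> nat set \<Rightarrow> bool" where
  "cyclic_interval n L \<longleftrightarrow> L \<subseteq> {1..2*n} \<and>
     (\<exists>i m. L = {i..i+m} \<or> {1..2*n} - L = {i..i+m})"

definition overlap_profile :: "nat set list \<Rightarrow> nat set \<Rightarrow> nat list" where
  "overlap_profile \<alpha> L = rev (sort (map (\<lambda>\<gamma>. card (\<gamma> \<inter> L)) \<alpha>))"

definition condition_M :: "nat \<Rightarrow> nat set list \<Rightarrow> nat set list \<Rightarrow> bool" where
  "condition_M n \<alpha> \<beta> \<longleftrightarrow>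
     (\<forall>L. cyclic_interval n L \<longrightarrow> majorizes (overlap_profile \<alpha> L) (overlap_profile \<beta> L))"

end

theory Submission
  imports Defs
begin

text \<open>For a cyclic interval \<open>L\<close> and a threshold \<open>j\<close> there is a family of totally positive matrices, with
  a parameter \<open>t \<ge> 1\<close>, along which every minor \<open>[\<gamma>]\<close> is, up to a factor common to all \<open>\<gamma>\<close>, of
  the exact order \<open>t ^ min |\<gamma> \<inter> L| j\<close>. Letting \<open>t\<close> grow, boundedness gives
  \<open>\<Sum> min |\<alpha>\<^sub>i \<inter> L| j \<le> \<Sum> min |\<beta>\<^sub>i \<inter> L| j\<close> for all \<open>j\<close>; together with the same inequality
  for the complement of \<open>L\<close> this is majorization.

  To build the family, work with \<open>2n \<times> n\<close> matrices with positive maximal minors: the lower block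
  can be normalized by column operations. If \<open>L\<close> consists of the first \<open>l\<close> rows, take the entries
  \<open>q ^ (i * k)\<close> with a large constant \<open>q\<close>, multiplied by \<open>t\<close> when \<open>i < l\<close> and \<open>k < j\<close>. Every maximal
  minor is then comparable to its diagonal product. Other intervals follow by cyclic rotation of
  the rows.\<close>

subsection \<open>Majorization and cyclic intervals\<close>

lemma sum_list_rev_sort:
  fixes xs :: "'a :: linorder list"
  shows "sum_list (map (f :: 'a \<Rightarrow> nat) (rev (sort xs))) = sum_list (map f xs)"
  by (metis mset_map mset_rev mset_sort sum_mset_sum_list)

text \<open>Subtraction on \<open>nat\<close> truncates, so each of the first \<open>k\<close>
  entries satisfies \<open>a \<le> j + (a - j)\<close>; the later entries only enlarge the
  right-hand side.\<close>

lemma sum_list_take_le_truncated: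
  fixes y :: "nat list"
  shows "sum_list (take k y) \<le> k * j + sum_list (map (\<lambda>v. v - j) y)"
proof (induction k arbitrary: y)
  case (Suc k)
  show ?case
  proof (cases y)
    case (Cons a z)
    then show ?thesis using Suc[of z] by simp
  qed simp
qed simp

text \<open>At the \<open>k\<close>-th largest entry \<open>j\<close> nothing is lost: the first
  \<open>k\<close> entries are at least \<open>j\<close>, so no subtraction truncates, and the later
  ones are at most \<open>j\<close> and contribute 0. With the previous bound, the sum of the
  \<open>k\<close> largest entries is the minimum over \<open>j\<close> of \<open>k * j\<close> plus
  the total excess over \<open>j\<close>.\<close>

lemma sum_list_take_eq_truncated:
  fixes x :: "nat list"
  assumes "sorted (rev x)" "0 < k" "k \<le> length x"
  defines "j \<equiv> x ! (k - 1)"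
  shows "sum_list (take k x) = k * j + sum_list (map (\<lambda>v. v - j) x)"
proof -
  have mono: "x ! b \<le> x ! a" if "a \<le> b" "b < length x" for a b
    using assms(1) that by (simp add: sorted_rev_iff_nth_mono)
  have 1: "sum_list (map (\<lambda>v. v - j) (drop k x)) = 0"
  proof -
    have "v \<le> j" if v: "v \<in> set (drop k x)" for v
    proof -
      obtain i where "i < length x - k" "v = x ! (k + i)"
        using v assms(3) by (auto simp: in_set_conv_nth)
      then show ?thesis using mono[of "k - 1" "k + i"] by (simp add: j_def)
    qed
    then show ?thesis by (auto simp: sum_list_eq_0_iff)
  qed
  have 2: "sum_list (take k x) = k * j + sum_list (map (\<lambda>v. v - j) (take k x))"
  proof -
    have ge: "v \<ge> j" if v: "v \<in> set (take k x)" for v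
    proof -
      obtain i where "i < k" "v = x ! i"
        using v assms(3) by (auto simp: in_set_conv_nth)
      then show ?thesis using mono[of i "k - 1"] assms by (simp add: j_def)
    qed
    have "sum_list z = length z * j + sum_list (map (\<lambda>v. v - j) z)" if "\<forall>v\<in>set z. v \<ge> j" for z :: "nat list"
      using that by (induction z) auto
    from this[of "take k x"] show ?thesis using ge assms(3) by simp
  qed
  have "sum_list (map (\<lambda>v. v - j) x) = sum_list (map (\<lambda>v. v - j) (take k x @ drop k x))" by simp
  also have "\<dots> = sum_list (map (\<lambda>v. v - j) (take k x)) + sum_list (map (\<lambda>v. v - j) (drop k x))"
    by (simp only: map_append sum_list_append)
  finally show ?thesis using 1 2 by simp
qed

text \<open>Since \<open>v = min v j + (v - j)\<close> and the totals agree, the inequality between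
  the truncated sums reverses for the excesses over \<open>j\<close>. Taking \<open>j\<close> to be
  the \<open>k\<close>-th largest entry of \<open>x\<close> makes the bound on the \<open>k\<close>
  largest entries exact for \<open>x\<close>, while it remains an upper bound for
  \<open>y\<close>.\<close>

lemma majorizes_if_truncated_sums_le:
  fixes x y :: "nat list"
  assumes len: "length x = length y" and sum: "sum_list x = sum_list y"
    and min: "\<And>j. sum_list (map (\<lambda>v. min v j) x) \<le> sum_list (map (\<lambda>v. min v j) y)"
  shows "majorizes (rev (sort x)) (rev (sort y))"
proof -
  let ?x = "rev (sort x)" and ?y = "rev (sort y)"
  have split: "sum_list z = sum_list (map (\<lambda>v. min v j) z) + sum_list (map (\<lambda>v. v - j) z)"
    for z :: "nat list" and j by (induction z) auto
  have diff: "sum_list (map (\<lambda>v. v - j) ?y) \<le> sum_list (map (\<lambda>v. v - j) ?x)" for j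
    using min[of j] split[of x j] split[of y j] sum by (simp only: sum_list_rev_sort)
  have "sum_list (take k ?y) \<le> sum_list (take k ?x)" if "k \<in> {1..length ?x}" for k
  proof -
    let ?j = "?x ! (k - 1)"
    have "sum_list (take k ?y) \<le> k * ?j + sum_list (map (\<lambda>v. v - ?j) ?y)"
      by (rule sum_list_take_le_truncated)
    also have "\<dots> \<le> k * ?j + sum_list (map (\<lambda>v. v - ?j) ?x)" using diff by simp
    also have "\<dots> = sum_list (take k ?x)"
      using that by (intro sum_list_take_eq_truncated[symmetric]) auto
    finally show ?thesis .
  qed
  moreover have "sum_list ?x = sum_list ?y"
    using sum sum_list_rev_sort[of id x] sum_list_rev_sort[of id y] by simp
  ultimately show ?thesis using len unfolding majorizes_def by auto
qed

section \<open>Cyclic intervals as rotated initial segments\<close>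

definition cyclic_shift :: "nat \<Rightarrow> nat \<Rightarrow> nat \<Rightarrow> nat" where
  "cyclic_shift n s x = (if s \<le> x then x - s else x + 2 * n - s)"

text \<open>Rotating so that the first element of \<open>L\<close> becomes row 0 turns
  \<open>L\<close> into the first \<open>l\<close> rows. For \<open>x < 2 * n\<close> and
  \<open>s \<le> 2 * n\<close>, \<open>cyclic_shift n s x\<close> is \<open>x - s\<close> modulo
  \<open>2 * n\<close>; \<open>Suc x\<close> translates the row number \<open>x\<close> into an
  element of \<open>{1..2*n}\<close>.\<close>

lemma cyclic_interval_shift:
  assumes "cyclic_interval n L"
  shows "\<exists>s\<le>2*n. \<exists>l. \<forall>x<2*n. Suc x \<in> L \<longleftrightarrow> cyclic_shift n s x < l"
proof -
  have sub: "L \<subseteq> {1..2*n}" using assms by (simp add: cyclic_interval_def)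
  from assms consider i m where "L = {i..i+m}" | i m where "{1..2*n} - L = {i..i+m}"
    unfolding cyclic_interval_def by auto
  then show ?thesis
  proof cases
    case 1
    then have "i \<in> L" "i + m \<in> L" by auto
    then have "1 \<le> i" "i + m \<le> 2 * n" using sub by auto
    then show ?thesis unfolding 1
      by (intro exI[of _ "i - 1"] exI[of _ "m + 1"] conjI allI impI) (auto simp: cyclic_shift_def)
  next
    case 2
    then have "i \<in> {1..2*n} - L" "i + m \<in> {1..2*n} - L" by auto
    then have im: "1 \<le> i" "i + m \<le> 2 * n" by auto
    have "Suc x \<in> L \<longleftrightarrow> \<not> (i \<le> Suc x \<and> Suc x \<le> i + m)" if "x < 2 * n" for x
    proof -
      have "Suc x \<in> {1..2*n} - L \<longleftrightarrow> Suc x \<in> {i..i+m}" using 2 by (rule arg_cong)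
      then show ?thesis using that by auto
    qed
    \<comment> \<open>In row numbers the complement is \<open>i - 1, ..., i + m - 1\<close>, so
      \<open>L\<close> starts cyclically at row \<open>i + m\<close> and has
      \<open>2 * n - (m + 1)\<close> elements. If the complement ends at \<open>2 * n\<close>, the
      shift is \<open>2 * n\<close>, which moves nothing.\<close>
    then show ?thesis using im
      by (intro exI[of _ "i + m"] exI[of _ "2 * n - (m + 1)"] conjI allI impI) (auto simp: cyclic_shift_def)
  qed
qed

lemma cyclic_interval_compl:
  assumes "cyclic_interval n L"
  shows "cyclic_interval n ({1..2*n} - L)"
  using assms by (auto simp: cyclic_interval_def double_diff)

subsection \<open>Determinants dominated by the diagonal\<close>

text \<open>Induction on \<open>n\<close>. If \<open>p\<close> fixes the last index, that factor
  splits off. Otherwise the pair of factors in the last row and the last column is uncrossed, which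
  gains the factor \<open>q\<close>; what remains is a product over a permutation of
  \<open>{0..<n}\<close>, and the inequality without \<open>q\<close> suffices for it.\<close>

lemma permutes_prod_le_diagonal:
  fixes P :: "nat \<Rightarrow> nat \<Rightarrow> real"
  assumes q: "q \<ge> 1"
    and pos: "\<And>i j. P i j > 0"
    and monge: "\<And>i i' j j'. i < i' \<Longrightarrow> j < j' \<Longrightarrow> i' < n \<Longrightarrow> j' < n \<Longrightarrow>
      q * (P i j' * P i' j) \<le> P i j * P i' j'"
    and p: "p permutes {0..<n}" "p \<noteq> id"
  shows "q * (\<Prod>i = 0..<n. P i (p i)) \<le> (\<Prod>i = 0..<n. P i i)"
  using monge p
proof (induction n arbitrary: p)
  case 0
  then show ?case by simp
next
  case (Suc n)
  \<comment> \<open>The weak form also covers the identity, which can be what is left after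
    uncrossing.\<close>
  have weak: "(\<Prod>i = 0..<n. P i (r i)) \<le> (\<Prod>i = 0..<n. P i i)"
    and strong: "r \<noteq> id \<Longrightarrow> q * (\<Prod>i = 0..<n. P i (r i)) \<le> (\<Prod>i = 0..<n. P i i)"
    if r: "r permutes {0..<n}" for r
  proof -
    show *: "q * (\<Prod>i = 0..<n. P i (r i)) \<le> (\<Prod>i = 0..<n. P i i)" if "r \<noteq> id"
      by (rule Suc.IH) (use Suc.prems r that in auto)
    have "1 * (\<Prod>i = 0..<n. P i (r i)) \<le> q * (\<Prod>i = 0..<n. P i (r i))"
      by (intro mult_right_mono q prod_nonneg) (auto simp: pos less_imp_le)
    then show "(\<Prod>i = 0..<n. P i (r i)) \<le> (\<Prod>i = 0..<n. P i i)"
      using * by (cases "r = id") auto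
  qed
  show ?case
  proof (cases "p n = n")
    case True
    have "p permutes {0..<n}"
      by (rule permutes_superset[OF Suc.prems(2)]) (use True in auto)
    from strong[OF this Suc.prems(3)] show ?thesis
      using True pos[of n n] by (simp add: mult.assoc[symmetric])
  next
    case False
    obtain a where a: "p a = n" using permutes_surj[OF Suc.prems(2)] by (metis surjD)
    have "a < Suc n" using a permutes_in_image[OF Suc.prems(2), of a] by simp
    with a False have an: "a < n" by (metis less_antisym)
    have "p n < Suc n" using permutes_in_image[OF Suc.prems(2), of n] by simp
    with False have bn: "p n < n" by simp
    \<comment> \<open>\<open>r\<close> sends \<open>a\<close> to \<open>p n\<close>, fixes
      \<open>n\<close> and agrees with \<open>p\<close> elsewhere.\<close>
    define r where "r = p \<circ> transpose a n"
    have "r permutes {0..<Suc n}" unfolding r_def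
      by (intro permutes_compose permutes_swap_id Suc.prems) (use an in auto)
    then have r: "r permutes {0..<n}"
      by (rule permutes_superset) (auto simp: r_def a)
    define R where "R = (\<Prod>i\<in>{0..<n}-{a}. P i (p i))"
    have R0: "R > 0" unfolding R_def by (intro prod_pos) (auto simp: pos)
    have "(\<Prod>i = 0..<n. P i (p i)) = P a n * R"
      unfolding R_def using an a by (subst prod.remove[of _ a]) auto
    then have 1: "(\<Prod>i = 0..<Suc n. P i (p i)) = (P a n * P n (p n)) * R" by simp
    have "(\<Prod>i\<in>{0..<n}-{a}. P i (r i)) = R" unfolding R_def
      by (intro prod.cong) (auto simp: r_def transpose_def)
    then have 2: "(\<Prod>i = 0..<n. P i (r i)) = P a (p n) * R"
      using an a by (subst prod.remove[of _ a]) (auto simp: r_def)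
    have "q * (\<Prod>i = 0..<Suc n. P i (p i)) = (q * (P a n * P n (p n))) * R"
      unfolding 1 by simp
    also have "\<dots> \<le> (P a (p n) * P n n) * R"
      by (intro mult_right_mono Suc.prems) (use an bn R0 in auto)
    also have "\<dots> = P n n * (\<Prod>i = 0..<n. P i (r i))" unfolding 2 by simp
    also have "\<dots> \<le> P n n * (\<Prod>i = 0..<n. P i i)"
      by (intro mult_left_mono weak r) (auto simp: pos less_imp_le)
    finally show ?thesis by (simp add: mult.commute)
  qed
qed

text \<open>In the Leibniz expansion every term other than the diagonal one is at most the diagonal
  product divided by \<open>2 * fact n\<close> in absolute value, and there are fewer than
  \<open>fact n\<close> such terms.\<close>

lemma det_near_diagonal:
  fixes P :: "nat \<Rightarrow> nat \<Rightarrow> real"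
  assumes pos: "\<And>i j. P i j > 0"
    and monge: "\<And>i i' j j'. i < i' \<Longrightarrow> j < j' \<Longrightarrow> i' < n \<Longrightarrow> j' < n \<Longrightarrow>
      2 * fact n * (P i j' * P i' j) \<le> P i j * P i' j'"
  shows "\<bar>det (mat n n (\<lambda>(i, j). P i j)) - (\<Prod>i = 0..<n. P i i)\<bar> \<le> (\<Prod>i = 0..<n. P i i) / 2"
proof -
  let ?S = "{p. p permutes {0..<n}}" and ?D = "\<Prod>i = 0..<n. P i i"
  define f where "f p = signof p * (\<Prod>i = 0..<n. P i (p i))" for p
  have fin: "finite ?S" by (simp add: finite_permutations)
  have id: "id \<in> ?S" by (simp add: permutes_id)
  have "det (mat n n (\<lambda>(i, j). P i j)) = (\<Sum>p\<in>?S. f p)"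
    by (subst det_def'[of _ n]) (auto simp: f_def permutes_in_image intro!: sum.cong prod.cong)
  also have "\<dots> = ?D + (\<Sum>p\<in>?S - {id}. f p)"
    by (subst sum.remove[OF fin id]) (simp add: f_def)
  finally have "\<bar>det (mat n n (\<lambda>(i, j). P i j)) - ?D\<bar> = \<bar>\<Sum>p\<in>?S - {id}. f p\<bar>" by simp
  also have "\<dots> \<le> (\<Sum>p\<in>?S - {id}. \<bar>f p\<bar>)" by (rule sum_abs)
  also have "\<dots> \<le> (\<Sum>p\<in>?S - {id}. ?D / (2 * fact n))"
  proof (rule sum_mono)
    fix p assume p: "p \<in> ?S - {id}"
    have "\<bar>f p\<bar> = (\<Prod>i = 0..<n. P i (p i))"
      by (auto simp: f_def abs_mult abs_prod sign_def pos less_imp_le)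
    moreover have "2 * fact n * (\<Prod>i = 0..<n. P i (p i)) \<le> ?D"
    proof (rule permutes_prod_le_diagonal[OF _ pos monge])
      show "1 \<le> 2 * (fact n :: real)" using fact_ge_1[of n, where 'a = real] by linarith
    qed (use p in auto)
    ultimately show "\<bar>f p\<bar> \<le> ?D / (2 * fact n)" by (simp add: field_simps)
  qed
  also have "\<dots> \<le> (\<Sum>p\<in>?S. ?D / (2 * fact n))"
    by (intro sum_mono2 fin) (auto simp: pos less_imp_le intro!: prod_nonneg divide_nonneg_nonneg)
  also have "\<dots> = ?D / 2" using fin by (simp add: card_permutations[of _ n])
  finally show ?thesis .
qed

text \<open>Both \<open>i * k\<close> and the indicator of \<open>i < l \<and> k < j\<close> are supermodular in \<open>(i, k)\<close>, so
  the diagonal product dominates every other term of a minor, by a factor independent of \<open>t\<close>.\<close>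

definition deform_entry :: "nat \<Rightarrow> nat \<Rightarrow> nat \<Rightarrow> real \<Rightarrow> nat \<Rightarrow> nat \<Rightarrow> real" where
  "deform_entry n l j t i k = (2 * fact n) ^ (i * k) * (if i < l \<and> k < j then t else 1)"

lemma card_initial:
  assumes "\<And>i i'. i \<le> i' \<Longrightarrow> i' < n \<Longrightarrow> Q i' \<Longrightarrow> Q i"
  shows "{i. i < n \<and> Q i} = {..<card {i. i < (n::nat) \<and> Q i}}"
proof -
  let ?A = "{i. i < n \<and> Q i}"
  have "i < card ?A" if "i \<in> ?A" for i
  proof -
    have "{..i} \<subseteq> ?A" using assms[of _ i] that by auto
    then have "card {..i} \<le> card ?A" by (intro card_mono) auto
    then show ?thesis by simp
  qed
  then have "?A \<subseteq> {..<card ?A}" by auto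
  then show ?thesis by (intro card_subset_eq) auto
qed

text \<open>The function \<open>g\<close> lists the selected rows in increasing order. The diagonal
  entry in position \<open>i\<close> carries the factor \<open>t\<close> exactly when
  \<open>g i < l\<close> and \<open>i < j\<close>, that is, when \<open>i < m\<close>; hence the
  diagonal product is \<open>t ^ m\<close> times a power of \<open>2 * fact n\<close> bounded
  independently of \<open>t\<close>. The determinant differs from this product by at most half of
  it.\<close>

lemma deform_entry_det_bounds:
  fixes g :: "nat \<Rightarrow> nat" and n l j :: nat and t :: real
  assumes g: "\<And>i i'. i < i' \<Longrightarrow> i' < n \<Longrightarrow> g i < g i'"
    and bound: "\<And>i. i < n \<Longrightarrow> g i \<le> 2 * n"
    and t: "t \<ge> 1"
  defines "d \<equiv> det (mat n n (\<lambda>(i, k). deform_entry n l j t (g i) k))"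
    and "m \<equiv> min (card {i. i < n \<and> g i < l}) j"
  shows "t ^ m / 2 \<le> d" and "d \<le> 2 * (2 * fact n) ^ (2 * n * n * n) * t ^ m"
proof -
  define q :: real where "q = 2 * fact n"
  have q: "q \<ge> 1" unfolding q_def using fact_ge_1[of n, where 'a = real] by linarith
  define P where "P i k = deform_entry n l j t (g i) k" for i k
  define w where "w i k = (if g i < l \<and> k < j then t else 1)" for i k
  have P: "P i k = q ^ (g i * k) * w i k" for i k
    by (simp add: P_def deform_entry_def q_def w_def)
  have pos: "P i k > 0" for i k using q t by (simp add: P w_def)
  have monge: "q * (P i k' * P i' k) \<le> P i k * P i' k'"
    if ik: "i < i'" "k < k'" "i' < n" for i i' k k'
  proof -
    have gi: "g i < g i'" using g ik by auto
    \<comment> \<open>A factor \<open>t\<close> in either crossed position forces one at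
      \<open>(i, k)\<close>; if both crossed positions carry it, all four do.\<close>
    have w: "w i k' * w i' k \<le> w i k * w i' k'" and w0: "w i k' * w i' k \<ge> 0"
      using gi ik t mult_mono[of 1 t 1 t] by (auto simp: w_def)
    obtain x where x: "g i' = g i + Suc x" using less_imp_Suc_add[OF gi] by auto
    obtain y where y: "k' = k + Suc y" using less_imp_Suc_add[OF ik(2)] by auto
    \<comment> \<open>The two exponents differ by \<open>(g i' - g i) * (k' - k)\<close>, which is
      at least 1; this supplies the factor \<open>q\<close>.\<close>
    have "Suc (g i * k' + g i' * k) \<le> g i * k + g i' * k'"
      unfolding x y by (simp add: algebra_simps)
    then have "q ^ Suc (g i * k' + g i' * k) \<le> q ^ (g i * k + g i' * k')"
      by (rule power_increasing[OF _ q])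
    then have "q ^ Suc (g i * k' + g i' * k) * (w i k' * w i' k)
        \<le> q ^ (g i * k + g i' * k') * (w i k * w i' k')"
      by (rule mult_mono[OF _ w _ w0]) (use q in auto)
    then show ?thesis unfolding P by (simp add: power_add mult_ac)
  qed
  define D where "D = (\<Prod>i = 0..<n. P i i)"
  have near: "\<bar>d - D\<bar> \<le> D / 2"
    using det_near_diagonal[of P n] pos monge
    unfolding d_def D_def P_def[symmetric] q_def[symmetric] by blast
  let ?c = "card {i. i < n \<and> g i < l}"
  have c: "g i < l \<longleftrightarrow> i < ?c" if "i < n" for i
  proof -
    have "{i. i < n \<and> g i < l} = {..<?c}"
    proof (rule card_initial)
      fix i i' assume "i \<le> i'" "i' < n" "g i' < l"
      then show "g i < l" using g[of i i'] by (cases "i = i'") auto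
    qed
    then show ?thesis using that by auto
  qed
  have c_le: "?c \<le> n" using card_mono[of "{..<n}" "{i. i < n \<and> g i < l}"] by auto
  have "(\<Prod>i = 0..<n. w i i) = (\<Prod>i\<in>{0..<n}. if i < m then t else 1)"
    by (intro prod.cong) (auto simp: w_def c m_def)
  also have "\<dots> = (\<Prod>i\<in>{0..<m}. t)"
    using c_le by (intro prod.mono_neutral_cong_right) (auto simp: m_def)
  finally have W: "(\<Prod>i = 0..<n. w i i) = t ^ m" by simp
  define e where "e = (\<Sum>i = 0..<n. g i * i)"
  have D: "D = q ^ e * t ^ m"
    unfolding D_def P prod.distrib W by (simp add: e_def power_sum)
  have "e \<le> (\<Sum>i = 0..<n. 2 * n * n)"
    unfolding e_def by (intro sum_mono mult_mono) (auto simp: bound less_imp_le)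
  then have "q ^ e \<le> q ^ (2 * n * n * n)" by (intro power_increasing q) (simp add: mult_ac)
  moreover have "1 \<le> q ^ e" using q by (rule one_le_power)
  ultimately have "t ^ m \<le> D" "D \<le> q ^ (2 * n * n * n) * t ^ m"
    unfolding D using t mult_right_mono[of 1 "q ^ e" "t ^ m"] by (auto intro: mult_right_mono)
  moreover have "D > 0" using \<open>t ^ m \<le> D\<close> t by (smt (verit) zero_less_power)
  ultimately show "t ^ m / 2 \<le> d" "d \<le> 2 * (2 * fact n) ^ (2 * n * n * n) * t ^ m"
    using near unfolding q_def[symmetric] by linarith+
qed

subsection \<open>Minors of the extended matrix\<close>

text \<open>An element of \<open>C\<close> of rank \<open>i\<close> moves up by one rank in
  \<open>insert c C\<close> exactly when it exceeds \<open>c\<close>. This is the renumbering done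
  by \<open>insert_index\<close> at the rank of \<open>c\<close>.\<close>

lemma pick_insert:
  assumes "finite C" "c \<notin> C" "i < card C"
  shows "pick (insert c C) (insert_index (card {a\<in>C. a < c}) i) = pick C i"
proof -
  define x where "x = pick C i"
  have x: "x \<in> C" and i: "card {a\<in>C. a < x} = i"
    unfolding x_def using assms by (auto intro: pick_in_set card_pick)
  have xc: "x \<noteq> c" using x assms by auto
  have "card {a \<in> insert c C. a < x} = insert_index (card {a\<in>C. a < c}) i"
  proof (cases "c < x")
    case True
    have "{a \<in> insert c C. a < x} = insert c {a\<in>C. a < x}" using True by auto
    then have "card {a \<in> insert c C. a < x} = Suc i" using assms i by simp
    moreover have "card {a\<in>C. a < c} \<le> card {a\<in>C. a < x}"
      using True assms(1) by (intro card_mono) auto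
    ultimately show ?thesis using i by simp
  next
    case False
    have "{a \<in> insert c C. a < x} = {a\<in>C. a < x}" using False by auto
    moreover have "card {a\<in>C. a < x} < card {a\<in>C. a < c}"
    proof (rule psubset_card_mono)
      have "x \<in> {a\<in>C. a < c}" "x \<notin> {a\<in>C. a < x}" using False xc x by auto
      moreover have "{a\<in>C. a < x} \<subseteq> {a\<in>C. a < c}" using False by auto
      ultimately show "{a\<in>C. a < x} \<subset> {a\<in>C. a < c}" by blast
    qed (simp add: assms(1))
    ultimately show ?thesis using i by simp
  qed
  then show ?thesis using pick_card_in_set[of x "insert c C"] x by (simp add: x_def)
qed

lemma submatrix_carrier:
  assumes "S \<subseteq> {..<dim_row A}" "T \<subseteq> {..<dim_col A}"
  shows "submatrix A S T \<in> carrier_mat (card S) (card T)"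
proof -
  have "{i. i < dim_row A \<and> i \<in> S} = S" "{i. i < dim_col A \<and> i \<in> T} = T" using assms by auto
  then show ?thesis by (intro carrier_matI) (simp_all only: dim_submatrix)
qed

lemma submatrix_entry:
  assumes "S \<subseteq> {..<dim_row A}" "T \<subseteq> {..<dim_col A}" "i < card S" "j < card T"
  shows "submatrix A S T $$ (i, j) = A $$ (pick S i, pick T j)"
proof -
  have "{i. i < dim_row A \<and> i \<in> S} = S" "{i. i < dim_col A \<and> i \<in> T} = T" using assms by auto
  then show ?thesis using assms by (simp add: submatrix_index)
qed

text \<open>Passing to a finite column set makes the rules that count columns with
  \<open>card\<close> applicable.\<close>

lemma submatrix_UNIV: "submatrix A S UNIV = submatrix A S {..<dim_col A}"
proof -
  have "pick {..<m} j = j" if "j < m" for m j :: nat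
  proof -
    have "{a \<in> {..<m}. a < j} = {..<j}" using that by auto
    then show ?thesis using pick_card_in_set[of j "{..<m}"] that by simp
  qed
  then show ?thesis
    by (auto intro!: eq_matI simp: submatrix_def pick_UNIV)
qed

lemma mat_delete_submatrix:
  assumes S: "insert r S \<subseteq> {..<dim_row A}" "r \<notin> S" and T: "insert c T \<subseteq> {..<dim_col A}" "c \<notin> T"
  shows "mat_delete (submatrix A (insert r S) (insert c T)) (card {a\<in>S. a < r}) (card {a\<in>T. a < c})
     = submatrix A S T"
proof -
  have fin: "finite S" "finite T" using S T by (auto dest: finite_subset)
  note c1 = submatrix_carrier[OF S(1) T(1)]
  have c2: "submatrix A S T \<in> carrier_mat (card S) (card T)"
    using S T by (intro submatrix_carrier) auto
  have ins: "insert_index k i < Suc m" if "i < m" for i k m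
    using that by (simp add: insert_index_def)
  let ?D = "mat_delete (submatrix A (insert r S) (insert c T)) (card {a\<in>S. a < r}) (card {a\<in>T. a < c})"
  show ?thesis
  proof (rule eq_matI)
    fix i j assume "i < dim_row (submatrix A S T)" "j < dim_col (submatrix A S T)"
    then have ij: "i < card S" "j < card T" using c2 by auto
    have "?D $$ (i, j)
      = submatrix A (insert r S) (insert c T) $$
          (insert_index (card {a\<in>S. a < r}) i, insert_index (card {a\<in>T. a < c}) j)"
      using c1 ij S T fin unfolding mat_delete_def insert_index_def by auto
    also have "\<dots> = A $$ (pick S i, pick T j)"
      using S T fin ij ins[of i "card S"] ins[of j "card T"] by (subst submatrix_entry) (auto simp: pick_insert)
    also have "\<dots> = submatrix A S T $$ (i, j)" using S T ij by (subst submatrix_entry) auto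
    finally show "?D $$ (i, j)
      = submatrix A S T $$ (i, j)" .
  qed (use c1 c2 S T fin in auto)
qed

text \<open>Laplace expansion along row \<open>r\<close>, whose only possibly nonzero entry among
  the chosen columns is in column \<open>c\<close>. The two cardinalities are the positions of
  \<open>r\<close> and \<open>c\<close> within the submatrix, so their sum gives the cofactor
  sign.\<close>

lemma det_submatrix_insert_single_entry:
  fixes A :: "'a :: comm_ring_1 mat"
  assumes S: "insert r S \<subseteq> {..<dim_row A}" "r \<notin> S" and T: "insert c T \<subseteq> {..<dim_col A}" "c \<notin> T"
    and card: "card S = card T"
    and zero: "\<And>k. k \<in> T \<Longrightarrow> A $$ (r, k) = 0"
  shows "det (submatrix A (insert r S) (insert c T))
     = A $$ (r, c) * (-1) ^ (card {a\<in>S. a < r} + card {a\<in>T. a < c}) * det (submatrix A S T)"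
proof -
  let ?M = "submatrix A (insert r S) (insert c T)"
  let ?i = "card {a\<in>S. a < r}" and ?j = "card {a\<in>T. a < c}"
  have fin: "finite S" "finite T" using S T by (auto dest: finite_subset)
  have M: "?M \<in> carrier_mat (Suc (card T)) (Suc (card T))"
    using submatrix_carrier[OF S(1) T(1)] S T fin card by simp
  have eqs: "{a \<in> insert r S. a < r} = {a\<in>S. a < r}" "{a \<in> insert c T. a < c} = {a\<in>T. a < c}" by auto
  have pr: "pick (insert r S) ?i = r" and pc: "pick (insert c T) ?j = c"
    using pick_card_in_set[of r "insert r S"] pick_card_in_set[of c "insert c T"] unfolding eqs by auto
  have "?i \<le> card S" "?j \<le> card T" using fin by (auto intro!: card_mono)
  then have i: "?i < Suc (card T)" and j: "?j < Suc (card T)" using card by auto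
  have entry: "?M $$ (?i, k) = A $$ (r, pick (insert c T) k)" if "k < Suc (card T)" for k
    using i that S T fin card pr by (subst submatrix_entry) auto
  have "?M $$ (?i, k) * cofactor ?M ?i k = 0" if "k < Suc (card T)" "k \<noteq> ?j" for k
  proof -
    have "pick (insert c T) k \<in> insert c T" using that T fin by (intro pick_in_set) auto
    moreover have "pick (insert c T) k \<noteq> pick (insert c T) ?j"
      using pick_mono[of ?j "insert c T" k] pick_mono[of k "insert c T" ?j] that j T fin
      by (cases "k < ?j") auto
    ultimately show ?thesis using zero that by (simp add: entry pc)
  qed
  then have "(\<Sum>k<Suc (card T). ?M $$ (?i, k) * cofactor ?M ?i k)
      = (\<Sum>k\<in>{?j}. ?M $$ (?i, k) * cofactor ?M ?i k)"
    using j by (intro sum.mono_neutral_right) auto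
  then have "det ?M = ?M $$ (?i, ?j) * cofactor ?M ?i ?j"
    unfolding laplace_expansion_row[OF M i] by simp
  then show ?thesis
    using j by (simp add: cofactor_def mat_delete_submatrix[OF S T] entry pc mult_ac)
qed

text \<open>Expanding along the last row: the columns to the right of its only nonzero entry are all
  still present, so the sign of the expansion cancels the sign of the entry.\<close>

lemma det_submatrix_extended_mat:
  assumes A: "A \<in> carrier_mat n n" and I: "I \<subseteq> {..<n}" and J: "J \<subseteq> {..<n}" and card: "card I = card J"
  shows "det (submatrix (extended_mat n A) (I \<union> (\<lambda>j. 2 * n - 1 - j) ` ({..<n} - J)) UNIV)
     = det (submatrix A I J)"
proof -
  let ?E = "extended_mat n A"
  \<comment> \<open>Row \<open>2 * n - 1 - j\<close> has its only nonzero entry in column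
    \<open>j\<close>. \<open>R m\<close> and \<open>C m\<close> are what is left after deleting
    these rows and columns for all \<open>j < m\<close> outside \<open>J\<close>: at
    \<open>m = 0\<close> the full minor, at \<open>m = n\<close> just \<open>I\<close> and
    \<open>J\<close>.\<close>
  define R where "R m = I \<union> (\<lambda>j. 2 * n - 1 - j) ` ({m..<n} - J)" for m
  define C where "C m = J \<union> {m..<n}" for m
  have dim: "dim_row ?E = 2 * n" "dim_col ?E = n" by (auto simp: extended_mat_def)
  have fin: "finite I" "finite J" using I J by (auto dest: finite_subset)
  have inj: "inj_on (\<lambda>j. 2 * n - 1 - j) ({m..<n} - J)" for m by (auto simp: inj_on_def)
  have cardC: "card (C m) = card J + card ({m..<n} - J)" for m
  proof -
    have "C m = J \<union> ({m..<n} - J)" by (auto simp: C_def)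
    then have "card (C m) = card (J \<union> ({m..<n} - J))" by (rule arg_cong)
    also have "\<dots> = card J + card ({m..<n} - J)" by (rule card_Un_disjoint) (use fin in auto)
    finally show ?thesis .
  qed
  have "card (R m) = card I + card ({m..<n} - J)" for m
  proof -
    have "I \<inter> (\<lambda>j. 2 * n - 1 - j) ` ({m..<n} - J) = {}" using I by fastforce
    then show ?thesis
      unfolding R_def using fin by (subst card_Un_disjoint)
        (simp_all only: card_image[OF inj] finite_imageI finite_Diff finite_atLeastLessThan)
  qed
  then have cardRC: "card (R m) = card (C m)" for m using cardC card by simp
  have Rsub: "R m \<subseteq> {..<2 * n}" and Csub: "C m \<subseteq> {..<n}" for m
    using I J by (auto simp: R_def C_def)
  have "det (submatrix ?E (R m) (C m)) = det (submatrix A I J)" if "m \<le> n" for m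
    using that
  proof (induction rule: inc_induct)
    case base
    have sub: "I \<subseteq> {..<2 * n}" "I \<subseteq> {..<n}" "J \<subseteq> {..<n}" using I J by auto
    have lt: "pick I i < n" "pick J i < n" if "i < card J" for i
      using pick_in_set[of i I] pick_in_set[of i J] that card I J by auto
    have "submatrix ?E I J = submatrix A I J"
    proof (rule eq_matI)
      fix i j assume "i < dim_row (submatrix A I J)" "j < dim_col (submatrix A I J)"
      then have ij: "i < card J" "j < card J"
        using submatrix_carrier[of I A J] sub A card by auto
      then show "submatrix ?E I J $$ (i, j) = submatrix A I J $$ (i, j)"
        using sub dim A card lt[OF ij(1)] lt[OF ij(2)]
        by (auto simp: submatrix_entry) (simp add: extended_mat_def)
    qed (use submatrix_carrier[of I A J] submatrix_carrier[of I ?E J] sub dim A in auto)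
    then show ?case by (simp add: R_def C_def)
  next
    case (step m)
    show ?case
    proof (cases "m \<in> J")
      case True
      then have "{m..<n} - J = {Suc m..<n} - J" "C m = C (Suc m)"
        using step.hyps by (auto simp: C_def) (metis Suc_leI le_neq_implies_less)+
      then show ?thesis using step.IH by (simp add: R_def)
    next
      case False
      let ?r = "2 * n - 1 - m"
      have "{m..<n} - J = insert m ({Suc m..<n} - J)" using step.hyps False by auto
      then have R: "R m = insert ?r (R (Suc m))" by (auto simp: R_def)
      have C: "C m = insert m (C (Suc m))" using step.hyps by (auto simp: C_def)
      have less: "a < ?r" if "a \<in> R (Suc m)" for a using that I step.hyps by (auto simp: R_def)
      then have r: "?r \<notin> R (Suc m)" by blast
      have c: "m \<notin> C (Suc m)" using False by (auto simp: C_def)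
      have fC: "finite (C (Suc m))" using Csub finite_subset by blast
      have "{a \<in> R (Suc m). a < ?r} = R (Suc m)" using less by auto
      then have "card {a \<in> R (Suc m). a < ?r} = card (C (Suc m))" by (simp add: cardRC)
      also have "\<dots> = card {a \<in> C (Suc m). a < m} + card {m<..<n}"
      proof -
        have "C (Suc m) = {a \<in> C (Suc m). a < m} \<union> {m<..<n}"
        proof (intro equalityI subsetI)
          fix a assume a: "a \<in> C (Suc m)"
          then have "a < n" "a \<noteq> m" using Csub[of "Suc m"] c by auto
          then show "a \<in> {a \<in> C (Suc m). a < m} \<union> {m<..<n}" using a by auto
        qed (auto simp: C_def)
        moreover have "{a \<in> C (Suc m). a < m} \<inter> {m<..<n} = {}" by auto
        ultimately show ?thesis using fC by (metis (lifting) card_Un_disjoint finite_Un)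
      qed
      finally have e: "card {a \<in> R (Suc m). a < ?r} + card {a \<in> C (Suc m). a < m}
          = 2 * card {a \<in> C (Suc m). a < m} + (n - 1 - m)" by simp
      have idx: "?r - n = n - 1 - m" "n - 1 - (n - 1 - m) = m" "\<not> ?r < n" "?r < 2 * n"
        using step.hyps by auto
      have "det (submatrix ?E (R m) (C m)) = ?E $$ (?r, m)
        * (-1) ^ (card {a \<in> R (Suc m). a < ?r} + card {a \<in> C (Suc m). a < m})
        * det (submatrix ?E (R (Suc m)) (C (Suc m)))"
        unfolding R C
      proof (rule det_submatrix_insert_single_entry[OF _ r _ c cardRC])
        show "insert ?r (R (Suc m)) \<subseteq> {..<dim_row ?E}" "insert m (C (Suc m)) \<subseteq> {..<dim_col ?E}"
          using Rsub[of m] Csub[of m] R C dim by auto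
        fix k assume k: "k \<in> C (Suc m)"
        then have "k < n" "k \<noteq> m" using Csub c by auto
        then show "?E $$ (?r, k) = 0" using idx by (simp add: extended_mat_def)
      qed
      also have "?E $$ (?r, m) = (-1) ^ (n - 1 - m)"
        using idx step.hyps by (simp add: extended_mat_def)
      finally show ?thesis
        unfolding e step.IH by (simp add: power_add[symmetric] flip: mult_2)
    qed
  qed
  from this[of 0] show ?thesis
    using J by (simp add: R_def C_def submatrix_UNIV dim atLeast0LessThan Un_absorb1)
qed

subsection \<open>A one-parameter family of totally positive matrices\<close>

lemma det_scale_rows:
  fixes c :: "nat \<Rightarrow> 'a :: comm_ring_1"
  shows "det (mat n n (\<lambda>(i, k). c i * P i k)) = (\<Prod>i = 0..<n. c i) * det (mat n n (\<lambda>(i, k). P i k))"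
proof -
  have "det (mat n n (\<lambda>(i, k). c i * P i k))
      = (\<Sum>p\<in>{p. p permutes {0..<n}}. (\<Prod>i = 0..<n. c i) * (signof p * (\<Prod>i = 0..<n. P i (p i))))"
    by (subst det_def'[of _ n])
      (auto simp: permutes_in_image prod.distrib[symmetric] mult.left_commute intro!: sum.cong prod.cong)
  also have "\<dots> = (\<Prod>i = 0..<n. c i) * det (mat n n (\<lambda>(i, k). P i k))"
    unfolding sum_distrib_left[symmetric]
    by (subst det_def'[of _ n]) (auto simp: permutes_in_image intro!: sum.cong prod.cong)
  finally show ?thesis .
qed

text \<open>Cyclically moving the first \<open>s\<close> rows to the end is compensated by the sign \<open>(-1)^(n-1)\<close> on these
  rows, so the maximal minors are those of the matrix of \<open>deform_entry\<close> at the shifted index set.\<close>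

definition deformation :: "nat \<Rightarrow> nat \<Rightarrow> nat \<Rightarrow> nat \<Rightarrow> real \<Rightarrow> real mat" where
  "deformation n s l j t = mat (2 * n) n (\<lambda>(i, k).
     (if i < s then (-1) ^ (n - 1) else 1) * deform_entry n l j t (cyclic_shift n s i) k)"

text \<open>Let \<open>r\<close> be the number of selected rows below \<open>s\<close>. Moving them
  after the other \<open>n - r\<close> selected rows puts the shifted indices in increasing order,
  so the bounds for \<open>deform_entry\<close> apply. The sign of this move cancels the product of
  the signs built into the \<open>r\<close> rows.\<close>

lemma deformation_minor_bounds:
  fixes n s l j :: nat and t :: real
  assumes S: "S \<subseteq> {..<2 * n}" "card S = n" and s: "s \<le> 2 * n" and t: "t \<ge> 1"
  defines "d \<equiv> det (submatrix (deformation n s l j t) S UNIV)"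
    and "m \<equiv> min (card {x\<in>S. cyclic_shift n s x < l}) j"
  shows "t ^ m / 2 \<le> d" and "d \<le> 2 * (2 * fact n) ^ (2 * n * n * n) * t ^ m"
proof -
  define f where "f = pick S"
  have f_in: "f i \<in> S" if "i < n" for i unfolding f_def using that S by (intro pick_in_set) auto
  have f_mono: "f i < f i'" if "i < i'" "i' < n" for i i'
    unfolding f_def using that S by (intro pick_mono) auto
  have f_lt: "f i < 2 * n" if "i < n" for i using f_in[OF that] S by auto
  define r where "r = card {i. i < n \<and> f i < s}"
  have "{i. i < n \<and> f i < s} = {..<r}" unfolding r_def
  proof (rule card_initial)
    fix i i' assume "i \<le> i'" "i' < n" "f i' < s"
    then show "f i < s" using f_mono[of i i'] by (cases "i = i'") auto
  qed
  then have fs: "f i < s \<longleftrightarrow> i < r" if "i < n" for i using that by auto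
  have rn: "r \<le> n" unfolding r_def using card_mono[of "{..<n}" "{i. i < n \<and> f i < s}"] by auto
  define e :: real where "e = (-1) ^ (n - 1)"
  \<comment> \<open>\<open>idx\<close> enumerates the selected rows in cyclic order starting from
    \<open>s\<close>.\<close>
  define idx where "idx i = (if i < n - r then i + r else i - (n - r))" for i
  have idx_lt: "idx i < n" if "i < n" for i using that rn by (auto simp: idx_def)
  define g where "g i = cyclic_shift n s (f (idx i))" for i
  have g: "g i = (if i < n - r then f (i + r) - s else f (i - (n - r)) + 2 * n - s)" if "i < n" for i
    using fs[OF idx_lt[OF that]] that rn by (auto simp: g_def cyclic_shift_def idx_def)
  have g_mono: "g i < g i'" if "i < i'" "i' < n" for i i'
  proof -
    have i: "i < n" using that by simp
    consider "i' < n - r" | "i < n - r" "\<not> i' < n - r" | "\<not> i < n - r" using that by linarith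
    then show ?thesis
    proof cases
      case 1
      have "i + r < n" using 1 that by linarith
      then have "s \<le> f (i + r)" using fs[of "i + r"] by auto
      moreover have "f (i + r) < f (i' + r)" using 1 that by (intro f_mono) auto
      ultimately show ?thesis using g[OF i] g[OF that(2)] 1 that by simp
    next
      \<comment> \<open>Rows from \<open>s\<close> on are shifted to indices below
        \<open>2 * n - s\<close>, the wrapped rows to indices from \<open>2 * n - s\<close>
        on.\<close>
      case 2
      then have "i + r < n" by linarith
      then have "f (i + r) < 2 * n" "s \<le> f (i + r)" using f_lt[of "i + r"] fs[of "i + r"] by auto
      then show ?thesis using g[OF i] g[OF that(2)] 2 that s by simp
    next
      case 3
      have "f (i - (n - r)) < f (i' - (n - r))" using 3 that by (intro f_mono) auto
      moreover have "a + 2 * n - s < b + 2 * n - s" if "a < b" for a b using that s by linarith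
      ultimately show ?thesis using g[OF i] g[OF that(2)] 3 that by simp
    qed
  qed
  have g_le: "g i \<le> 2 * n" if "i < n" for i
  proof (cases "i < n - r")
    case True
    then have "f (i + r) < 2 * n" by (intro f_lt) auto
    then show ?thesis using g[OF that] True by simp
  next
    case False
    then have "f (i - (n - r)) < s" using fs[of "i - (n - r)"] that rn by auto
    then show ?thesis using g[OF that] False by simp
  qed

  let ?h = "\<lambda>i. f (idx i)"
  have inj: "inj_on ?h {..<n}"
  proof (rule inj_onI)
    fix i i' assume "i \<in> {..<n}" "i' \<in> {..<n}" "?h i = ?h i'"
    then show "i = i'" using g_mono[of i i'] g_mono[of i' i] by (auto simp: g_def intro: linorder_cases[of i i'])
  qed
  have "?h ` {..<n} = S"
    using S f_in idx_lt inj finite_subset[OF S(1)] by (intro card_subset_eq) (auto simp: card_image)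
  then have "{x\<in>S. cyclic_shift n s x < l} = ?h ` {i. i < n \<and> g i < l}" by (auto simp: g_def)
  then have card: "card {x\<in>S. cyclic_shift n s x < l} = card {i. i < n \<and> g i < l}"
    using inj by (simp add: card_image inj_on_subset subset_iff)

  let ?Q = "mat n n (\<lambda>(i, k). deform_entry n l j t (g i) k)"
  define N where "N = submatrix (deformation n s l j t) S UNIV"
  have dims: "dim_row (deformation n s l j t) = 2 * n" "dim_col (deformation n s l j t) = n"
    by (simp_all add: deformation_def)
  have N_carrier: "N \<in> carrier_mat n n"
    unfolding N_def submatrix_UNIV using submatrix_carrier[of S "deformation n s l j t" "{..<n}"] S dims by simp
  have N: "N $$ (i, k) = (if i < r then e else 1) * deform_entry n l j t (cyclic_shift n s (f i)) k"
    if "i < n" "k < n" for i k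
  proof -
    have "N $$ (i, k) = deformation n s l j t $$ (f i, k)"
      unfolding N_def f_def using that S dims
      by (subst submatrix_index) (auto simp: pick_UNIV Collect_conj_eq Int_absorb1 subset_eq lessThan_def)
    then show ?thesis using that f_lt fs by (simp add: deformation_def e_def)
  qed
  have "det N = (-1) ^ (r * (n - r)) * det (mat n n (\<lambda>(i, k).
      N $$ (if i < n - r then i + r else if i < r + (n - r) then i - (n - r) else i, k)))"
    by (rule det_swap_initial_rows[OF N_carrier]) (use rn in simp)
  also have "mat n n (\<lambda>(i, k).
      N $$ (if i < n - r then i + r else if i < r + (n - r) then i - (n - r) else i, k))
      = mat n n (\<lambda>(i, k). (if i < n - r then 1 else e) * deform_entry n l j t (g i) k)"
    using rn by (intro cong_mat) (auto simp: N g_def idx_def)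
  also have "det \<dots> = (\<Prod>i = 0..<n. if i < n - r then 1 else e) * det ?Q"
    by (rule det_scale_rows)
  also have "(\<Prod>i = 0..<n. if i < n - r then 1 else e) = (\<Prod>i\<in>{n - r..<n}. e)"
    by (intro prod.mono_neutral_cong_right) auto
  also have "\<dots> = (-1) ^ ((n - 1) * r)" using rn by (simp add: e_def power_mult)
  also have "(-1) ^ (r * (n - r)) * ((-1) ^ ((n - 1) * r) * det ?Q)
     = ((-1) ^ (r * (n - r) + (n - 1) * r)) * det ?Q"
    by (simp add: power_add)
  \<comment> \<open>For \<open>n > 0\<close> the exponent is \<open>r * (2 * n - 1 - r)\<close>, a
    product of two numbers of opposite parity; for \<open>n = 0\<close> also
    \<open>r = 0\<close>.\<close>
  also have "(-1 :: real) ^ (r * (n - r) + (n - 1) * r) = 1"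
    using rn by (cases n; cases "even r") auto
  finally have d: "d = det ?Q" by (simp add: d_def N_def)
  show "t ^ m / 2 \<le> d" "d \<le> 2 * (2 * fact n) ^ (2 * n * n * n) * t ^ m"
    unfolding d m_def card using g_mono g_le t by (intro deform_entry_det_bounds; simp)+
qed

section \<open>Normalizing the lower block by column operations\<close>

lemma submatrix_mult_right:
  assumes "M \<in> carrier_mat a b" "X \<in> carrier_mat b b" "S \<subseteq> {..<a}"
  shows "submatrix (M * X) S UNIV = submatrix M S UNIV * X"
proof -
  have 1: "submatrix (M * X) S UNIV \<in> carrier_mat (card S) b"
    and 2: "submatrix M S UNIV \<in> carrier_mat (card S) b"
    unfolding submatrix_UNIV
    using submatrix_carrier[of S "M * X" "{..<b}"] submatrix_carrier[of S M "{..<b}"] assms by auto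
  show ?thesis
  proof (rule eq_matI)
    fix i j assume "i < dim_row (submatrix M S UNIV * X)" "j < dim_col (submatrix M S UNIV * X)"
    then have ij: "i < card S" "j < b" using 2 assms by auto
    have sub: "submatrix C S UNIV $$ (i, k) = C $$ (pick S i, k)"
      if "C \<in> carrier_mat a b" "k < b" for C :: "'a mat" and k
      using that ij assms(3)
      by (subst submatrix_index) (auto simp: pick_UNIV Collect_conj_eq Int_absorb1 subset_eq lessThan_def)
    have pick: "pick S i < a" using pick_in_set[of i S] ij assms(3) by auto
    have row: "row (submatrix M S UNIV) i = row M (pick S i)"
      using 2 ij pick assms sub[OF assms(1)] by (intro eq_vecI) auto
    have "submatrix (M * X) S UNIV $$ (i, j) = (M * X) $$ (pick S i, j)"
      using assms ij by (intro sub) auto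
    also have "\<dots> = row M (pick S i) \<bullet> col X j" using assms pick ij by simp
    also have "\<dots> = (submatrix M S UNIV * X) $$ (i, j)" using 2 ij assms by (simp add: row)
    finally show "submatrix (M * X) S UNIV $$ (i, j) = (submatrix M S UNIV * X) $$ (i, j)" .
  qed (use 1 2 assms in auto)
qed

text \<open>Column operations bring the lower block of \<open>M\<close> to the lower block of an extended matrix;
  they multiply all maximal minors by one common factor.\<close>

lemma totally_positive_of_positive_maximal_minors:
  fixes M :: "real mat"
  assumes M: "M \<in> carrier_mat (2 * n) n"
    and pos: "\<And>S. S \<subseteq> {..<2 * n} \<Longrightarrow> card S = n \<Longrightarrow> det (submatrix M S UNIV) > 0"
  obtains A \<kappa> where "totally_positive n A" "\<kappa> > 0"
    "\<And>\<gamma>. index_set n \<gamma> \<Longrightarrow> minor n \<gamma> A = \<kappa> * det (submatrix M ((\<lambda>r. r - 1) ` \<gamma>) UNIV)"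
proof -
  define B where "B = submatrix M {n..<2 * n} UNIV"
  define D :: "real mat" where "D = mat n n (\<lambda>(i, j). if j = n - 1 - i then (-1) ^ i else 0)"
  have low: "{n..<2 * n} \<subseteq> {..<2 * n}" by auto
  have B: "B \<in> carrier_mat n n"
    unfolding B_def submatrix_UNIV using submatrix_carrier[of "{n..<2 * n}" M "{..<n}"] M low by simp
  have D: "D \<in> carrier_mat n n" by (simp add: D_def)
  have dB: "det B > 0" unfolding B_def by (rule pos) auto
  \<comment> \<open>This is the inverse of \<open>B\<close> times \<open>D\<close>, written with the
    adjugate. It replaces the lower block \<open>B\<close> of \<open>M\<close> by \<open>D\<close>,
    the lower block of an extended matrix.\<close>
  define X where "X = (1 / det B) \<cdot>\<^sub>m (adj_mat B * D)"
  note adj = adj_mat[OF B]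
  have X: "X \<in> carrier_mat n n" using adj D by (simp add: X_def)
  have "B * X = (1 / det B) \<cdot>\<^sub>m (B * (adj_mat B * D))"
    unfolding X_def using adj B D by (intro mult_smult_distrib) auto
  also have "B * (adj_mat B * D) = (B * adj_mat B) * D" using adj B D by (intro assoc_mult_mat[symmetric]) auto
  also have "\<dots> = det B \<cdot>\<^sub>m (1\<^sub>m n * D)"
    unfolding adj(2) using D by (intro mult_smult_assoc_mat) auto
  also have "(1 / det B) \<cdot>\<^sub>m \<dots> = D" using D dB by (auto intro!: eq_matI)
  finally have BX: "B * X = D" .
  define A where "A = mat n n (\<lambda>(i, j). (M * X) $$ (i, j))"
  have A: "A \<in> carrier_mat n n" by (simp add: A_def)
  have sub: "submatrix (M * X) S UNIV = submatrix M S UNIV * X" if "S \<subseteq> {..<2 * n}" for S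
    using submatrix_mult_right[OF M X that] .
  have ext: "extended_mat n A = M * X"
  proof (rule eq_matI)
    fix i j assume "i < dim_row (M * X)" "j < dim_col (M * X)"
    then have ij: "i < 2 * n" "j < n" using M X by auto
    show "extended_mat n A $$ (i, j) = (M * X) $$ (i, j)"
    proof (cases "i < n")
      case True
      then show ?thesis using ij by (simp add: extended_mat_def A_def)
    next
      case False
      have eq: "{a \<in> {n..<2 * n}. a < i} = {n..<i}" using ij by auto
      have pick: "pick {n..<2 * n} (i - n) = i"
        using pick_card_in_set[of i "{n..<2 * n}"] ij False unfolding eq by simp
      have "{i. i < 2 * n \<and> i \<in> {n..<2 * n}} = {n..<2 * n}" by auto
      then have "submatrix (M * X) {n..<2 * n} UNIV $$ (i - n, j) = (M * X) $$ (i, j)"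
        using M X ij False by (subst submatrix_index) (auto simp: pick_UNIV pick)
      moreover have "submatrix (M * X) {n..<2 * n} UNIV = D" using sub[OF low] BX by (simp add: B_def)
      ultimately show ?thesis using False ij by (auto simp: extended_mat_def D_def)
    qed
  qed (use M X in \<open>auto simp: extended_mat_def\<close>)
  have det_ext: "det (submatrix (extended_mat n A) S UNIV) = det X * det (submatrix M S UNIV)"
    if S: "S \<subseteq> {..<2 * n}" "card S = n" for S
  proof -
    have "submatrix M S UNIV \<in> carrier_mat n n"
      unfolding submatrix_UNIV using submatrix_carrier[of S M "{..<n}"] M S by auto
    then show ?thesis unfolding ext sub[OF S(1)] using det_mult[of _ n X] X by simp
  qed
  \<comment> \<open>The minor with \<open>I\<close> and \<open>J\<close> empty shows that the lower
    block of an extended matrix has determinant 1. Hence \<open>det X\<close> is the reciprocal of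
    \<open>det B\<close> and is positive.\<close>
  have "{} \<union> (\<lambda>j. 2 * n - 1 - j) ` ({..<n} - {}) = {n..<2 * n}"
  proof
    show "{n..<2 * n} \<subseteq> {} \<union> (\<lambda>j. 2 * n - 1 - j) ` ({..<n} - {})"
    proof
      fix x assume "x \<in> {n..<2 * n}"
      then show "x \<in> {} \<union> (\<lambda>j. 2 * n - 1 - j) ` ({..<n} - {})"
        by (auto intro!: image_eqI[of _ _ "2 * n - 1 - x"])
    qed
  qed auto
  moreover have "det (submatrix A {} {}) = 1" by (rule det_dim_zero) (auto simp: submatrix_def)
  ultimately have "det (submatrix (extended_mat n A) {n..<2 * n} UNIV) = 1"
    using det_submatrix_extended_mat[OF A, of "{}" "{}"] by simp
  then have "det X * det B = 1" using det_ext[OF low] by (simp add: B_def)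
  then have X0: "det X > 0" using zero_less_mult_pos2[of "det X" "det B"] dB by simp
  have "totally_positive n A"
    unfolding totally_positive_def
  proof (intro conjI A allI impI)
    fix I J assume IJ: "I \<subseteq> {..<n} \<and> J \<subseteq> {..<n} \<and> I \<noteq> {} \<and> card I = card J"
    let ?R = "I \<union> (\<lambda>j. 2 * n - 1 - j) ` ({..<n} - J)"
    have fin: "finite I" "finite J" using IJ finite_subset by blast+
    have "card ?R = card I + card ((\<lambda>j. 2 * n - 1 - j) ` ({..<n} - J))"
    proof (rule card_Un_disjoint)
      show "I \<inter> (\<lambda>j. 2 * n - 1 - j) ` ({..<n} - J) = {}" using IJ by fastforce
    qed (use fin in auto)
    also have "card ((\<lambda>j. 2 * n - 1 - j) ` ({..<n} - J)) = card ({..<n} - J)"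
      by (rule card_image) (auto simp: inj_on_def)
    also have "\<dots> = n - card J" using IJ fin by (simp add: card_Diff_subset)
    finally have "card ?R = n" using IJ card_mono[of "{..<n}" J] by simp
    moreover have "?R \<subseteq> {..<2 * n}" using IJ by auto
    ultimately have "det (submatrix (extended_mat n A) ?R UNIV) > 0"
      using det_ext[of ?R] pos[of ?R] X0 by simp
    then show "0 < det (submatrix A I J)"
      using det_submatrix_extended_mat[OF A, of I J] IJ by simp
  qed
  moreover have "minor n \<gamma> A = det X * det (submatrix M ((\<lambda>r. r - 1) ` \<gamma>) UNIV)" if "index_set n \<gamma>" for \<gamma>
  proof -
    have "inj_on (\<lambda>r. r - 1) \<gamma>" using that by (auto simp: index_set_def inj_on_def subset_iff)
      (metis Suc_pred less_eq_Suc_le)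
    then have "card ((\<lambda>r. r - 1) ` \<gamma>) = n" using that by (simp add: card_image index_set_def)
    moreover have "(\<lambda>r. r - 1) ` \<gamma> \<subseteq> {..<2 * n}" using that by (force simp: index_set_def)
    ultimately show ?thesis unfolding minor_def by (intro det_ext)
  qed
  ultimately show ?thesis using X0 that by blast
qed

subsection \<open>Necessity of condition (M)\<close>

lemma prod_list_power_bounds:
  fixes u :: "'a \<Rightarrow> real"
  assumes t: "t \<ge> 0" and c: "c \<ge> 0"
    and bounds: "\<And>x. x \<in> set xs \<Longrightarrow> c * t ^ e x \<le> u x" "\<And>x. x \<in> set xs \<Longrightarrow> u x \<le> C * t ^ e x"
  shows "c ^ length xs * t ^ sum_list (map e xs) \<le> prod_list (map u xs)"
    and "prod_list (map u xs) \<le> C ^ length xs * t ^ sum_list (map e xs)"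
proof -
  have "c ^ length xs * t ^ sum_list (map e xs) \<le> prod_list (map u xs) \<and>
      prod_list (map u xs) \<le> C ^ length xs * t ^ sum_list (map e xs)"
    using bounds
  proof (induction xs)
    case (Cons a xs)
    have nn: "0 \<le> c * t ^ e a" "0 \<le> c ^ length xs * t ^ sum_list (map e xs)" using t c by auto
    have a: "c * t ^ e a \<le> u a" "u a \<le> C * t ^ e a" using Cons.prems by auto
    have IH: "c ^ length xs * t ^ sum_list (map e xs) \<le> prod_list (map u xs)"
      "prod_list (map u xs) \<le> C ^ length xs * t ^ sum_list (map e xs)"
      using Cons by auto
    have "(c * t ^ e a) * (c ^ length xs * t ^ sum_list (map e xs)) \<le> u a * prod_list (map u xs)"
      by (rule mult_mono) (use a IH nn in auto)
    moreover have "u a * prod_list (map u xs) \<le> (C * t ^ e a) * (C ^ length xs * t ^ sum_list (map e xs))"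
      by (rule mult_mono) (use a IH nn in linarith)+
    ultimately show ?case by (simp add: power_add mult_ac)
  qed simp
  then show "c ^ length xs * t ^ sum_list (map e xs) \<le> prod_list (map u xs)"
    "prod_list (map u xs) \<le> C ^ length xs * t ^ sum_list (map e xs)" by auto
qed

text \<open>If the exponent for \<open>\<alpha>\<close> exceeded the one for \<open>\<beta>\<close>,
  the ratio would be at least \<open>t / (2 * C) ^ length \<beta>\<close> along the family, hence
  unbounded. The normalizing factor \<open>\<kappa>\<close> cancels because both products have the
  same number of factors.\<close>

lemma bounded_ratio_truncated_overlap:
  assumes len: "length \<alpha> = length \<beta>"
    and index: "\<forall>\<gamma>\<in>set \<alpha>. index_set n \<gamma>" "\<forall>\<gamma>\<in>set \<beta>. index_set n \<gamma>"
    and bounded: "bounded_ratio n \<alpha> \<beta>" and L: "cyclic_interval n L"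
  shows "(\<Sum>\<gamma>\<leftarrow>\<alpha>. min (card (\<gamma> \<inter> L)) j) \<le> (\<Sum>\<gamma>\<leftarrow>\<beta>. min (card (\<gamma> \<inter> L)) j)"
proof (rule ccontr)
  let ?e = "\<lambda>\<gamma>. min (card (\<gamma> \<inter> L)) j"
  let ?a = "\<Sum>\<gamma>\<leftarrow>\<alpha>. ?e \<gamma>" and ?b = "\<Sum>\<gamma>\<leftarrow>\<beta>. ?e \<gamma>"
  assume "\<not> ?a \<le> ?b"
  then have ab: "Suc ?b \<le> ?a" by simp
  obtain s l where s: "s \<le> 2 * n"
    and sl: "\<And>x. x < 2 * n \<Longrightarrow> Suc x \<in> L \<longleftrightarrow> cyclic_shift n s x < l"
    using cyclic_interval_shift[OF L] by blast
  obtain k where k: "k > 0" "\<And>A. totally_positive n A \<Longrightarrow> minor_prod n \<alpha> A / minor_prod n \<beta> A \<le> k"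
    using bounded unfolding bounded_ratio_def by blast
  define C :: real where "C = 2 * (2 * fact n) ^ (2 * n * n * n)"
  have C: "C > 0" by (simp add: C_def)
  let ?p = "length \<beta>"
  \<comment> \<open>Chosen to push that lower bound for the ratio above \<open>k\<close>. Neither
    \<open>C\<close> nor this choice involves \<open>\<kappa>\<close>, which itself may depend on
    \<open>t\<close>.\<close>
  define t where "t = 1 + k * (2 * C) ^ ?p"
  have t: "t \<ge> 1" "t > k * (2 * C) ^ ?p" using k(1) C by (simp_all add: t_def)
  let ?M = "deformation n s l j t"
  have M: "?M \<in> carrier_mat (2 * n) n" by (simp add: deformation_def)
  have "det (submatrix ?M S UNIV) > 0" if "S \<subseteq> {..<2 * n}" "card S = n" for S
    by (rule less_le_trans[OF _ deformation_minor_bounds(1)[OF that s t(1)]]) (use t in simp)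
  then obtain A \<kappa> where A: "totally_positive n A" and \<kappa>: "\<kappa> > 0"
    and minor: "\<And>\<gamma>. index_set n \<gamma> \<Longrightarrow> minor n \<gamma> A = \<kappa> * det (submatrix ?M ((\<lambda>r. r - 1) ` \<gamma>) UNIV)"
    using totally_positive_of_positive_maximal_minors[OF M] by blast
  have bounds: "\<kappa> / 2 * t ^ ?e \<gamma> \<le> minor n \<gamma> A" "minor n \<gamma> A \<le> \<kappa> * C * t ^ ?e \<gamma>"
    if \<gamma>: "index_set n \<gamma>" for \<gamma>
  proof -
    let ?S = "(\<lambda>r. r - 1) ` \<gamma>"
    have sub: "\<gamma> \<subseteq> {1..2 * n}" and card: "card \<gamma> = n" using \<gamma> by (auto simp: index_set_def)
    have inj: "inj_on (\<lambda>r. r - 1) \<gamma>" using sub by (intro inj_on_diff_nat) auto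
    have S: "?S \<subseteq> {..<2 * n}" "card ?S = n" using sub inj card by (force, simp add: card_image)
    have "{x \<in> ?S. cyclic_shift n s x < l} = (\<lambda>r. r - 1) ` (\<gamma> \<inter> L)"
    proof -
      have "cyclic_shift n s (r - 1) < l \<longleftrightarrow> r \<in> L" if "r \<in> \<gamma>" for r
      proof -
        have "1 \<le> r" "r \<le> 2 * n" using that sub by auto
        then show ?thesis using sl[of "r - 1"] by simp
      qed
      then show ?thesis by auto
    qed
    then have e: "card {x \<in> ?S. cyclic_shift n s x < l} = card (\<gamma> \<inter> L)"
      using inj by (simp add: card_image inj_on_Int)
    let ?d = "det (submatrix ?M ?S UNIV)"
    have d: "t ^ ?e \<gamma> / 2 \<le> ?d" "?d \<le> C * t ^ ?e \<gamma>"
      using deformation_minor_bounds[OF S s t(1), of l j] unfolding e C_def .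
    show "\<kappa> / 2 * t ^ ?e \<gamma> \<le> minor n \<gamma> A" "minor n \<gamma> A \<le> \<kappa> * C * t ^ ?e \<gamma>"
      using mult_left_mono[OF d(1), of \<kappa>] mult_left_mono[OF d(2), of \<kappa>] \<kappa> minor[OF \<gamma>]
      by (simp_all add: mult.assoc)
  qed
  have num: "(\<kappa> / 2) ^ ?p * t ^ ?a \<le> minor_prod n \<alpha> A"
    unfolding minor_prod_def len[symmetric]
    by (rule prod_list_power_bounds(1)[where C = "\<kappa> * C"]) (use bounds index t \<kappa> in auto)
  have den: "minor_prod n \<beta> A \<le> (\<kappa> * C) ^ ?p * t ^ ?b"
    unfolding minor_prod_def
    by (rule prod_list_power_bounds(2)[where c = "\<kappa> / 2"]) (use bounds index t \<kappa> in auto)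
  have "(\<kappa> / 2) ^ ?p * t ^ ?b \<le> minor_prod n \<beta> A"
    unfolding minor_prod_def
    by (rule prod_list_power_bounds(1)[where C = "\<kappa> * C"]) (use bounds index t \<kappa> in auto)
  moreover have "0 < (\<kappa> / 2) ^ ?p * t ^ ?b" using \<kappa> t by simp
  ultimately have den0: "minor_prod n \<beta> A > 0" by linarith
  have "(\<kappa> / 2) ^ ?p * t ^ Suc ?b \<le> (\<kappa> / 2) ^ ?p * t ^ ?a"
    using ab t \<kappa> by (intro mult_left_mono power_increasing) auto
  also have "\<dots> \<le> minor_prod n \<alpha> A" by (rule num)
  also have "\<dots> \<le> k * minor_prod n \<beta> A" using k(2)[OF A] den0 by (simp add: field_simps)
  also have "\<dots> \<le> k * ((\<kappa> * C) ^ ?p * t ^ ?b)" using den k by simp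
  \<comment> \<open>The upper and lower constants have quotient \<open>2 * C\<close>, free of
    \<open>\<kappa>\<close>.\<close>
  also have "(\<kappa> * C) ^ ?p = (\<kappa> / 2) ^ ?p * (2 * C) ^ ?p" unfolding power_mult_distrib[symmetric] by simp
  finally have "((\<kappa> / 2) ^ ?p * t ^ ?b) * t \<le> ((\<kappa> / 2) ^ ?p * t ^ ?b) * (k * (2 * C) ^ ?p)"
    by (simp only: power_Suc mult.assoc mult.commute mult.left_commute)
  then have "t \<le> k * (2 * C) ^ ?p"
    using \<open>0 < (\<kappa> / 2) ^ ?p * t ^ ?b\<close> by (rule mult_left_le_imp_le)
  then show False using t by simp
qed

theorem theorem15:
  fixes n p :: nat and \<alpha> \<beta> :: "nat set list"
  assumes "n \<ge> 1" and "p \<ge> 1"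
    and "length \<alpha> = p" and "length \<beta> = p"
    and "\<forall>\<gamma>\<in>set \<alpha>. index_set n \<gamma>" and "\<forall>\<gamma>\<in>set \<beta>. index_set n \<gamma>"
    and "bounded_ratio n \<alpha> \<beta>"
  shows "condition_M n \<alpha> \<beta>"
  unfolding condition_M_def
proof (intro allI impI)
  fix L assume L: "cyclic_interval n L"
  have len: "length \<alpha> = length \<beta>" using assms by simp
  note truncated = bounded_ratio_truncated_overlap[OF len assms(5-7)]
  have le_n: "card (\<gamma> \<inter> K) \<le> n" if "index_set n \<gamma>" for \<gamma> K
    using that finite_subset[of \<gamma> "{1..2 * n}"] card_mono[of \<gamma> "\<gamma> \<inter> K"] by (auto simp: index_set_def)
  \<comment> \<open>No overlap exceeds \<open>n\<close>, so the threshold \<open>j = n\<close>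
    truncates nothing and gives the inequality for plain sums.\<close>
  have sum_le: "(\<Sum>\<gamma>\<leftarrow>\<alpha>. card (\<gamma> \<inter> K)) \<le> (\<Sum>\<gamma>\<leftarrow>\<beta>. card (\<gamma> \<inter> K))" if "cyclic_interval n K" for K
  proof -
    have "(\<Sum>\<gamma>\<leftarrow>\<delta>. min (card (\<gamma> \<inter> K)) n) = (\<Sum>\<gamma>\<leftarrow>\<delta>. card (\<gamma> \<inter> K))" if "\<forall>\<gamma>\<in>set \<delta>. index_set n \<gamma>" for \<delta>
      using that le_n by (intro arg_cong[of _ _ sum_list] map_cong) auto
    then show ?thesis using truncated[OF that, of n] assms(5,6) by simp
  qed
  have compl: "(\<Sum>\<gamma>\<leftarrow>\<delta>. card (\<gamma> \<inter> L)) + (\<Sum>\<gamma>\<leftarrow>\<delta>. card (\<gamma> \<inter> ({1..2*n} - L))) = length \<delta> * n"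
    if "\<forall>\<gamma>\<in>set \<delta>. index_set n \<gamma>" for \<delta>
    using that
  proof (induction \<delta>)
    case (Cons \<gamma> \<delta>)
    have \<gamma>: "\<gamma> \<subseteq> {1..2*n}" "card \<gamma> = n" "finite \<gamma>"
      using Cons.prems finite_subset[of \<gamma> "{1..2*n}"] by (auto simp: index_set_def)
    then have "\<gamma> \<inter> ({1..2*n} - L) = \<gamma> - L" by auto
    then have "card (\<gamma> \<inter> L) + card (\<gamma> \<inter> ({1..2*n} - L)) = n"
      using card_Int_Diff[OF \<gamma>(3), of L] \<gamma>(2) by simp
    then show ?case using Cons by simp
  qed simp
  \<comment> \<open>The overlaps with \<open>L\<close> and with its complement add up to the same
    total for \<open>\<alpha>\<close> and \<open>\<beta>\<close>, so the inequality for the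
    complement is the reverse inequality for \<open>L\<close>.\<close>
  have sum_eq: "(\<Sum>\<gamma>\<leftarrow>\<alpha>. card (\<gamma> \<inter> L)) = (\<Sum>\<gamma>\<leftarrow>\<beta>. card (\<gamma> \<inter> L))"
    using sum_le[OF L] sum_le[OF cyclic_interval_compl[OF L]] compl[OF assms(5)] compl[OF assms(6)] len
    by simp
  show "majorizes (overlap_profile \<alpha> L) (overlap_profile \<beta> L)"
    unfolding overlap_profile_def
  proof (rule majorizes_if_truncated_sums_le)
    fix j
    show "(\<Sum>v\<leftarrow>map (\<lambda>\<gamma>. card (\<gamma> \<inter> L)) \<alpha>. min v j) \<le> (\<Sum>v\<leftarrow>map (\<lambda>\<gamma>. card (\<gamma> \<inter> L)) \<beta>. min v j)"
      using truncated[OF L, of j] by (simp add: comp_def)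
  qed (use len sum_eq in auto)
qed

end
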